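(* Let $X$ be a real Banach space and let $Y$ be a strict ideal of $X$, with $Y^*$ identified with the subspace $P(X^* )$ of $X^*$, where $P$ is the projection witnessing that $Y$ is a strict ideal. If $y^* \in B_{Y^*}$ is a $w^*$-denting point of $B_{Y^*}$, then $y^*$ (regarded as an element of $X^*$ through this identification) is a $w^*$-denting point of $B_{X^*}$.
   Context: $B_X$ denotes the closed unit ball of a Banach space $X$, and $X^*$ its dual. For a bounded set $C \subseteq X^*$, $x \in X$ with $\|x\| = 1$ and $\alpha > 0$, the set $\{x^* \in C : x^*(x) > \sup_{c^* \in C} c^*(x) - \alpha\}$ is called a (open) $w^*$-slice of $C$. A point $x^* \neq 0$ of a convex set $K \subseteq X^*$ is a $w^*$-denting point of $K$ if for every $\varepsilon > 0$ there is a $w^*$-slice $S$ of $K$ with $x^* \in S$ and $\operatorname{diam}(S) < \varepsilon$. For $B_{Y^*}$, $w^*$-slices are taken with respect to elements of $Y$; for $B_{X^*}$, with respect to elements of $X$. A closed subspace $Y \subseteq X$ is an ideal if there is a linear projection $P : X^* \to X^*$ with $\|P\| = 1$ and $\ker(P) = Y^\perp = \{x^* \in X^* : x^*|_Y = 0\}$. It is a strict ideal if, for such a projection $P$, one also has that $B_{P(X^* )}$ is $w^*$-dense in $B_{X^*}$ (equivalently, $B_{P(X^* )}$ is a norming set for $X$: $\|x\| = \sup\{|x^*(x)| : x^* \in B_{P(X^* )}\}$ for all $x \in X$). For an ideal $Y$, $Y^*$ is isometrically identified with $P(X^* )$ by sending $y^* \in Y^*$ to $P(x^* )$, where $x^*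 \in X^*$ is any extension of $y^*$; the element $P(x^* )$ is a norm-preserving extension of $y^*$. *)

theory Defs
  imports "HOL-Analysis.Analysis"
begin

text \<open>
  The dual of a normed space is the library type of bounded linear functions into the reals, and
  the weak-star topology on it is pointwise convergence, that is, \<^const>\<open>strong_operator_topology\<close>.
\<close>

type_synonym 'a dual = "'a \<Rightarrow>\<^sub>L real"

definition wstar_slice :: "'a::real_normed_vector dual set \<Rightarrow> 'a \<Rightarrow> real \<Rightarrow> 'a dual set" where
  "wstar_slice C x \<alpha> = {f \<in> C. blinfun_apply f x > (SUP g\<in>C. blinfun_apply g x) - \<alpha>}"

text \<open>
  The real-valued supremum in \<^const>\<open>wstar_slice\<close> and \<^const>\<open>diameter\<close> are meaningful for bounded sets;
  below only dual unit balls occur.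
\<close>

definition wstar_denting_point :: "'a::real_normed_vector dual set \<Rightarrow> 'a dual \<Rightarrow> bool" where
  "wstar_denting_point K f \<longleftrightarrow> f \<in> K \<and> f \<noteq> 0 \<and>
     (\<forall>\<epsilon>>0. \<exists>x \<alpha>. norm x = 1 \<and> \<alpha> > 0 \<and> f \<in> wstar_slice K x \<alpha> \<and> diameter (wstar_slice K x \<alpha>) < \<epsilon>)"

text \<open>
  A linear subspace \<open>Y\<close> is a set and not a type, so its dual consists of functions on the ambient
  type that are \<^const>\<open>undefined\<close> off \<open>Y\<close>. This makes equality of functionals equality on \<open>Y\<close>.
  The norm only looks at values on \<open>Y\<close>, so it may be applied to pointwise differences.
\<close>

definition dual_on :: "'a::real_normed_vector set \<Rightarrow> ('a \<Rightarrow> real) set" where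
  "dual_on Y = {f \<in> extensional Y.
     (\<forall>x\<in>Y. \<forall>y\<in>Y. f (x + y) = f x + f y) \<and>
     (\<forall>c. \<forall>x\<in>Y. f (c *\<^sub>R x) = c * f x) \<and>
     (\<exists>B. \<forall>x\<in>Y. \<bar>f x\<bar> \<le> B * norm x)}"

definition dual_norm_on :: "'a::real_normed_vector set \<Rightarrow> ('a \<Rightarrow> real) \<Rightarrow> real" where
  "dual_norm_on Y f = (SUP y\<in>Y \<inter> cball 0 1. \<bar>f y\<bar>)"

definition dual_ball_on :: "'a::real_normed_vector set \<Rightarrow> ('a \<Rightarrow> real) set" where
  "dual_ball_on Y = {f \<in> dual_on Y. dual_norm_on Y f \<le> 1}"

definition dual_diameter_on :: "'a::real_normed_vector set \<Rightarrow> ('a \<Rightarrow> real) set \<Rightarrow> real" where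
  "dual_diameter_on Y S =
     (if S = {} then 0 else SUP (f, g)\<in>S \<times> S. dual_norm_on Y (\<lambda>y. f y - g y))"

definition wstar_slice_on :: "('a \<Rightarrow> real) set \<Rightarrow> 'a \<Rightarrow> real \<Rightarrow> ('a \<Rightarrow> real) set" where
  "wstar_slice_on C y \<alpha> = {f \<in> C. f y > (SUP g\<in>C. g y) - \<alpha>}"

definition wstar_denting_point_on ::
    "'a::real_normed_vector set \<Rightarrow> ('a \<Rightarrow> real) set \<Rightarrow> ('a \<Rightarrow> real) \<Rightarrow> bool" where
  "wstar_denting_point_on Y K f \<longleftrightarrow> f \<in> K \<and> (\<exists>y\<in>Y. f y \<noteq> 0) \<and>
     (\<forall>\<epsilon>>0. \<exists>y\<in>Y. \<exists>\<alpha>. norm y = 1 \<and> \<alpha> > 0 \<and>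
        f \<in> wstar_slice_on K y \<alpha> \<and> dual_diameter_on Y (wstar_slice_on K y \<alpha>) < \<epsilon>)"

definition annihilator :: "'a::real_normed_vector set \<Rightarrow> 'a dual set" where
  "annihilator Y = {f. \<forall>y\<in>Y. blinfun_apply f y = 0}"

definition ideal_projection :: "'a::real_normed_vector set \<Rightarrow> ('a dual \<Rightarrow>\<^sub>L 'a dual) \<Rightarrow> bool" where
  "ideal_projection Y P \<longleftrightarrow> subspace Y \<and> closed Y \<and>
     P o\<^sub>L P = P \<and> norm P = 1 \<and> {f. blinfun_apply P f = 0} = annihilator Y"

definition strict_ideal_projection ::
    "'a::real_normed_vector set \<Rightarrow> ('a dual \<Rightarrow>\<^sub>L 'a dual) \<Rightarrow> bool" where
  "strict_ideal_projection Y P \<longleftrightarrow> ideal_projection Y P \<and>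
     cball 0 1 \<subseteq> strong_operator_topology closure_of (range (blinfun_apply P) \<inter> cball 0 1)"

text \<open>
  The identification of the dual of \<open>Y\<close> with the range of \<open>P\<close>: extend, then project. An extension
  exists by Hahn-Banach; the choice is irrelevant since \<open>P\<close> kills functionals vanishing on \<open>Y\<close>.
\<close>

definition ideal_embedding ::
    "'a::real_normed_vector set \<Rightarrow> ('a dual \<Rightarrow>\<^sub>L 'a dual) \<Rightarrow> ('a \<Rightarrow> real) \<Rightarrow> 'a dual" where
  "ideal_embedding Y P f = blinfun_apply P (SOME g. \<forall>y\<in>Y. blinfun_apply g y = f y)"

lemma ideal_embedding_eq:
  assumes "ideal_projection Y P" and "\<And>y. y \<in> Y \<Longrightarrow> blinfun_apply g y = f y"
  shows "ideal_embedding Y P f = blinfun_apply P g"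
proof -
  define h where "h = (SOME g. \<forall>y\<in>Y. blinfun_apply g y = f y)"
  have "\<forall>y\<in>Y. blinfun_apply h y = f y"
    unfolding h_def by (rule someI[of _ g]) (use assms(2) in blast)
  then have "h - g \<in> annihilator Y"
    using assms(2) by (simp add: annihilator_def minus_blinfun.rep_eq)
  then have "blinfun_apply P (h - g) = 0"
    using assms(1) unfolding ideal_projection_def by blast
  then show ?thesis
    by (simp add: ideal_embedding_def h_def blinfun.diff_right)
qed

text \<open>For \<open>Y = UNIV\<close> the relative notions are the ones for the library's dual.\<close>

lemma dual_norm_on_UNIV: "dual_norm_on UNIV (blinfun_apply f) = norm f"
proof -
  have bdd: "bdd_above ((\<lambda>y. \<bar>blinfun_apply f y\<bar>) ` cball 0 1)"
  proof (rule bdd_aboveI2)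
    fix y :: 'a assume "y \<in> cball 0 1"
    then show "\<bar>blinfun_apply f y\<bar> \<le> norm f * 1"
      using norm_blinfun[of f y] mult_left_mono[of "norm y" 1 "norm f"] by auto
  qed
  have "(SUP y\<in>cball 0 1. \<bar>blinfun_apply f y\<bar>) \<le> norm f"
  proof (rule cSUP_least)
    fix y :: 'a assume "y \<in> cball 0 1"
    then show "\<bar>blinfun_apply f y\<bar> \<le> norm f"
      using norm_blinfun[of f y] mult_left_mono[of "norm y" 1 "norm f"] by auto
  qed auto
  moreover have "norm f \<le> (SUP y\<in>cball 0 1. \<bar>blinfun_apply f y\<bar>)" (is "_ \<le> ?s")
  proof (rule norm_blinfun_bound)
    have up: "\<bar>blinfun_apply f y\<bar> \<le> ?s" if "norm y \<le> 1" for y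
      by (rule cSUP_upper[OF _ bdd]) (use that in simp)
    show "0 \<le> ?s" using up[of 0] by simp
    show "norm (blinfun_apply f y) \<le> ?s * norm y" for y
    proof (cases "y = 0")
      case False
      then show ?thesis
        using up[of "y /\<^sub>R norm y"] by (simp add: blinfun.scaleR_right abs_mult field_simps)
    qed simp
  qed
  ultimately show ?thesis
    by (simp add: dual_norm_on_def)
qed

lemma dual_on_UNIV: "dual_on UNIV = range blinfun_apply"
proof (intro set_eqI iffI)
  fix f :: "'a \<Rightarrow> real" assume "f \<in> dual_on UNIV"
  then obtain B where f: "\<And>x y. f (x + y) = f x + f y" "\<And>c x. f (c *\<^sub>R x) = c * f x"
      "\<And>x. \<bar>f x\<bar> \<le> B * norm x"
    by (auto simp: dual_on_def)
  have "bounded_linear f"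
    by (rule bounded_linear_intro[of _ B]) (use f in \<open>auto simp: mult.commute\<close>)
  then show "f \<in> range blinfun_apply"
    by (metis bounded_linear_Blinfun_apply rangeI)
next
  fix f :: "'a \<Rightarrow> real" assume "f \<in> range blinfun_apply"
  then obtain g where "f = blinfun_apply g" by auto
  then show "f \<in> dual_on UNIV"
    using norm_blinfun[of g]
    by (auto simp: dual_on_def blinfun.add_right blinfun.scaleR_right intro!: exI[of _ "norm g"])
qed

lemma dual_ball_on_UNIV: "dual_ball_on UNIV = blinfun_apply ` cball 0 1"
  by (auto simp: dual_ball_on_def dual_on_UNIV dual_norm_on_UNIV)

lemma wstar_slice_on_UNIV:
  "wstar_slice_on (blinfun_apply ` K) x \<alpha> = blinfun_apply ` wstar_slice K x \<alpha>"
  by (auto simp: wstar_slice_on_def wstar_slice_def image_image)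

lemma dual_diameter_on_UNIV: "dual_diameter_on UNIV (blinfun_apply ` S) = diameter S"
proof -
  have "dual_norm_on UNIV (\<lambda>y. blinfun_apply f y - blinfun_apply g y) = dist f g"
    for f g :: "'a dual"
    using dual_norm_on_UNIV[of "f - g"] by (simp add: minus_blinfun.rep_eq dist_norm)
  moreover have "blinfun_apply ` S \<times> blinfun_apply ` S = map_prod blinfun_apply blinfun_apply ` (S \<times> S)"
    by auto
  ultimately show ?thesis
    by (simp add: dual_diameter_on_def diameter_def image_image case_prod_unfold)
qed

lemma wstar_denting_point_on_UNIV:
  "wstar_denting_point_on UNIV (dual_ball_on UNIV) (blinfun_apply f) \<longleftrightarrow>
   wstar_denting_point (cball 0 1) f"
proof -
  have "f \<noteq> 0 \<longleftrightarrow> (\<exists>y. blinfun_apply f y \<noteq> 0)"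
    by (metis blinfun_eqI zero_blinfun.rep_eq)
  then show ?thesis
    by (simp add: wstar_denting_point_on_def wstar_denting_point_def dual_ball_on_UNIV
        wstar_slice_on_UNIV dual_diameter_on_UNIV inj_image_mem_iff blinfun_apply_inject inj_def)
qed

end

theory Submission
  imports Defs
begin

text \<open>
  Let \<open>y \<in> Y\<close> and \<open>\<alpha>\<close> cut a small slice out of the ball of the dual of \<open>Y\<close>; the same \<open>y\<close> and \<open>\<alpha>\<close>
  cut a small slice out of the ball of the dual of \<open>X\<close>. By Hahn--Banach, restriction to \<open>Y\<close> maps
  the big ball onto the small one, and it is isometric on the range of \<open>P\<close>. Hence the functionals
  of the big slice that lie in the range of \<open>P\<close> are close to each other. They are weak-star dense
  in the slice, which is relatively weak-star open, and the norm is weak-star lower semicontinuous,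
  so the diameter of the big slice is no larger.
\<close>

section \<open>The Hahn--Banach theorem\<close>

text \<open>Homogeneity is asked only as an inequality for positive factors, which is what passes to
  infima directly; using it for a factor and its inverse gives equality.\<close>

definition sublinear :: "('a::real_vector \<Rightarrow> real) \<Rightarrow> bool" where
  "sublinear q \<longleftrightarrow> (\<forall>x y. q (x + y) \<le> q x + q y) \<and> (\<forall>a>0. \<forall>x. q (a *\<^sub>R x) \<le> a * q x)"

lemma sublinear_add: "sublinear q \<Longrightarrow> q (x + y) \<le> q x + q y"
  by (simp add: sublinear_def)

lemma sublinear_zero:
  assumes "sublinear q"
  shows "q 0 = 0"
proof -
  \<comment> \<open>Halving forces \<open>q 0 \<le> 0\<close>, doubling forces
    \<open>q 0 \<ge> 0\<close>.\<close>
  have "q ((1/2) *\<^sub>R 0) \<le> (1/2) * q 0" "q (2 *\<^sub>R 0) \<le> 2 * q 0"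
    using assms unfolding sublinear_def by (meson zero_less_numeral half_gt_zero_iff zero_less_one)+
  then show ?thesis by simp
qed

lemma sublinear_scaleR:
  assumes "sublinear q" "0 \<le> a"
  shows "q (a *\<^sub>R x) = a * q x"
proof (cases "a = 0")
  case True
  then show ?thesis using sublinear_zero[OF assms(1)] by simp
next
  case False
  then have a: "a > 0" using assms(2) by simp
  have "q (inverse a *\<^sub>R (a *\<^sub>R x)) \<le> inverse a * q (a *\<^sub>R x)"
    using assms(1) a unfolding sublinear_def by (meson positive_imp_inverse_positive)
  then have "a * q x \<le> q (a *\<^sub>R x)"
    using a by (simp add: field_simps)
  moreover have "q (a *\<^sub>R x) \<le> a * q x"
    using assms(1) a unfolding sublinear_def by blast
  ultimately show ?thesis by simp
qed

lemma sublinear_minus_le: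
  assumes "sublinear q"
  shows "- q (- x) \<le> q x"
  using sublinear_add[OF assms, of x "- x"] sublinear_zero[OF assms] by simp

text \<open>Oddness reverses subadditivity: \<open>q x\<close> is at most
  \<open>q (x + y) + q (- y)\<close>, that is, \<open>q (x + y) - q y\<close>.\<close>

lemma sublinear_odd_imp_linear:
  assumes q: "sublinear q" and odd: "\<And>x. q (- x) = - q x"
  shows "linear q"
proof (rule linearI)
  fix x y
  show "q (x + y) = q x + q y"
    using sublinear_add[OF q, of x y] sublinear_add[OF q, of "x + y" "- y"] odd[of y] by simp
next
  fix a x
  show "q (a *\<^sub>R x) = a *\<^sub>R q x"
  proof (cases "0 \<le> a")
    case True
    then show ?thesis using sublinear_scaleR[OF q] by simp
  next
    case False
    then show ?thesis
      using sublinear_scaleR[OF q, of "- a" x] odd[of "a *\<^sub>R x"] by simp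
  qed
qed

text \<open>The infimal convolution of \<open>q\<close> with a functional that is linear on a cone.\<close>

lemma sublinear_below_on_cone:
  assumes q: "sublinear q" and C0: "0 \<in> C"
    and Cadd: "\<And>x y. x \<in> C \<Longrightarrow> y \<in> C \<Longrightarrow> x + y \<in> C"
    and Cscale: "\<And>a x. a > 0 \<Longrightarrow> x \<in> C \<Longrightarrow> a *\<^sub>R x \<in> C"
    and gadd: "\<And>x y. x \<in> C \<Longrightarrow> y \<in> C \<Longrightarrow> g (x + y) = g x + g y"
    and gscale: "\<And>a x. a > 0 \<Longrightarrow> x \<in> C \<Longrightarrow> g (a *\<^sub>R x) = a * g x"
    and gq: "\<And>x. x \<in> C \<Longrightarrow> - q (- x) \<le> g x"
  obtains r where "sublinear r" "\<And>x. r x \<le> q x" "\<And>x. x \<in> C \<Longrightarrow> r x \<le> g x"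
proof
  define r where "r x = (INF c\<in>C. q (x - c) + g c)" for x
  \<comment> \<open>A bound independent of \<open>c\<close>, from \<open>gq\<close> and
    \<open>- c = (x - c) + (- x)\<close>; it keeps the infimum finite.\<close>
  have lower: "- q (- x) \<le> q (x - c) + g c" if "c \<in> C" for x c
    using gq[OF that] sublinear_add[OF q, of "x - c" "- x"] by simp
  have bdd: "bdd_below ((\<lambda>c. q (x - c) + g c) ` C)" for x
    by (rule bdd_belowI2[of _ "- q (- x)"]) (rule lower)
  have r_le: "r x \<le> q (x - c) + g c" if "c \<in> C" for x c
    unfolding r_def by (rule cINF_lower[OF bdd that])
  have le_r: "t \<le> r x" if "\<And>c. c \<in> C \<Longrightarrow> t \<le> q (x - c) + g c" for t x
    unfolding r_def by (rule cINF_greatest) (use C0 that in auto)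
  show "sublinear r"
    unfolding sublinear_def
  proof (intro conjI allI impI)
    fix x y
    \<comment> \<open>The point \<open>c + d\<close> competes in the infimum at
      \<open>x + y\<close>. The infima are then taken one at a time, first over \<open>d\<close>,
      then over \<open>c\<close>.\<close>
    have "r (x + y) - (q (x - c) + g c) \<le> q (y - d) + g d" if "c \<in> C" "d \<in> C" for c d
    proof -
      have "r (x + y) \<le> q ((x + y) - (c + d)) + g (c + d)"
        by (rule r_le) (use that Cadd in auto)
      also have "\<dots> \<le> q (x - c) + q (y - d) + (g c + g d)"
        using sublinear_add[OF q, of "x - c" "y - d"] gadd[OF that] by (simp add: algebra_simps)
      finally show ?thesis by simp
    qed
    then have "r (x + y) - (q (x - c) + g c) \<le> r y" if "c \<in> C" for c
      using that by (intro le_r) blast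
    then have "r (x + y) - r y \<le> r x"
      by (intro le_r) (simp add: algebra_simps)
    then show "r (x + y) \<le> r x + r y" by simp
  next
    fix a :: real and x assume a: "a > 0"
    have "r (a *\<^sub>R x) / a \<le> q (x - c) + g c" if "c \<in> C" for c
    proof -
      have "r (a *\<^sub>R x) \<le> q (a *\<^sub>R x - a *\<^sub>R c) + g (a *\<^sub>R c)"
        by (rule r_le) (use that a Cscale in auto)
      also have "\<dots> = a * (q (x - c) + g c)"
        using sublinear_scaleR[OF q, of a "x - c"] a gscale[OF a that]
        by (simp add: algebra_simps)
      finally show ?thesis using a by (simp add: field_simps)
    qed
    then have "r (a *\<^sub>R x) / a \<le> r x" by (rule le_r)
    then show "r (a *\<^sub>R x) \<le> a * r x" using a by (simp add: field_simps)
  qed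
  \<comment> \<open>The competitor \<open>c = 0\<close> gives the bound by \<open>q\<close>, and
    \<open>c = x\<close> the bound by \<open>g\<close> on \<open>C\<close>.\<close>
  have "g 0 = 0" using gadd[OF C0 C0] by simp
  then show "r x \<le> q x" for x
    using r_le[OF C0, of x] by simp
  show "r x \<le> g x" if "x \<in> C" for x
    using r_le[OF that, of x] sublinear_zero[OF q] by simp
qed

text \<open>Supplies the lower bounds for Zorn's lemma. The pointwise infimum is finite since each
  member satisfies \<open>- p (- x) \<le> - q (- x) \<le> q x\<close>; it is subadditive since the
  smaller of two members bounds both summands.\<close>

lemma sublinear_INF_chain:
  assumes ne: "Q \<noteq> {}" and sub: "\<And>q. q \<in> Q \<Longrightarrow> sublinear q \<and> q \<le> p"
    and chain: "\<And>q r. q \<in> Q \<Longrightarrow> r \<in> Q \<Longrightarrow> q \<le> r \<or> r \<le> q"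
  obtains u where "sublinear u" "u \<le> p" "\<And>q. q \<in> Q \<Longrightarrow> u \<le> q"
proof
  define u where "u x = (INF q\<in>Q. q x)" for x
  have lower: "- p (- x) \<le> q x" if "q \<in> Q" for x q
    using sublinear_minus_le[of q x] sub[OF that] le_funD[of q p "- x"] by auto
  have u_le: "u x \<le> q x" if "q \<in> Q" for x q
    unfolding u_def
    by (rule cINF_lower[OF _ that]) (rule bdd_belowI2[of _ "- p (- x)"], rule lower)
  have le_u: "t \<le> u x" if "\<And>q. q \<in> Q \<Longrightarrow> t \<le> q x" for t x
    unfolding u_def by (rule cINF_greatest[OF ne that])
  show "\<And>q. q \<in> Q \<Longrightarrow> u \<le> q" by (auto simp: le_fun_def u_le)
  with ne sub show "u \<le> p" by (meson equals0I order_trans)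
  show "sublinear u"
    unfolding sublinear_def
  proof (intro conjI allI impI)
    fix x y
    have "u (x + y) - q x \<le> r y" if "q \<in> Q" "r \<in> Q" for q r
    proof -
      obtain s where s: "s \<in> Q" "s \<le> q" "s \<le> r"
        using chain \<open>q \<in> Q\<close> \<open>r \<in> Q\<close> by blast
      have "u (x + y) \<le> s x + s y"
        using u_le[OF s(1), of "x + y"] sublinear_add[of s x y] sub[OF s(1)] by simp
      also have "\<dots> \<le> q x + r y"
        using s by (intro add_mono) (auto simp: le_fun_def)
      finally show ?thesis by simp
    qed
    then have "u (x + y) - q x \<le> u y" if "q \<in> Q" for q
      using that by (intro le_u) blast
    then have "u (x + y) - u y \<le> u x"
      by (intro le_u) (simp add: algebra_simps)
    then show "u (x + y) \<le> u x + u y" by simp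
  next
    fix a :: real and x assume a: "a > 0"
    have "u (a *\<^sub>R x) / a \<le> q x" if "q \<in> Q" for q
      using u_le[OF that, of "a *\<^sub>R x"] sublinear_scaleR[of q a x] sub[OF that] a
      by (simp add: field_simps)
    then have "u (a *\<^sub>R x) / a \<le> u x" by (rule le_u)
    then show "u (a *\<^sub>R x) \<le> a * u x" using a by (simp add: field_simps)
  qed
qed

text \<open>
  A minimal sublinear functional \<open>q\<close> is odd, hence linear: otherwise it could be lowered at \<open>- z\<close>
  by convolving it with \<open>- t *\<^sub>R z \<mapsto> - t * q z\<close> on the ray through \<open>- z\<close>.
\<close>

lemma linear_below_sublinear:
  assumes p: "sublinear p"
  obtains h where "linear h" "h \<le> p"
proof -
  define A where "A = {q. sublinear q \<and> q \<le> p}"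
  \<comment> \<open>Zorn's lemma for the reversed pointwise order, so that a maximal element is a
    minimal functional; \<open>p\<close> itself bounds the empty chain.\<close>
  have "\<exists>m\<in>A. \<forall>a\<in>A. m \<ge> a \<longrightarrow> a = m"
  proof (rule predicate_Zorn)
    show "partial_order_on A (relation_of (\<ge>) A)"
      by (rule partial_order_on_relation_ofI) auto
    fix Q assume "Q \<in> Chains (relation_of (\<ge>) A)"
    then have Q: "q \<in> A" "r \<in> A" "q \<le> r \<or> r \<le> q" if "q \<in> Q" "r \<in> Q" for q r
      using that by (auto simp: Chains_def relation_of_def)
    show "\<exists>u\<in>A. \<forall>q\<in>Q. q \<ge> u"
    proof (cases "Q = {}")
      case True
      then show ?thesis using p by (auto simp: A_def)
    next
      case False
      have "sublinear q \<and> q \<le> p" if "q \<in> Q" for q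
        using Q(1)[OF that that] by (simp add: A_def)
      then obtain u where "sublinear u" "u \<le> p" "\<And>q. q \<in> Q \<Longrightarrow> u \<le> q"
        using sublinear_INF_chain[OF False] Q(3) by metis
      then show ?thesis by (auto simp: A_def)
    qed
  qed
  \<comment> \<open>Minimality in \<open>A\<close> is minimality among all sublinear functionals
    below \<open>q\<close>, as these also lie below \<open>p\<close>.\<close>
  then obtain q where q: "sublinear q" "q \<le> p"
    and minimal: "\<And>r. sublinear r \<Longrightarrow> r \<le> q \<Longrightarrow> r = q"
    unfolding A_def using order_trans by blast
  have "q (- z) = - q z" for z
  proof -
    define C where "C = (\<lambda>t. - (t *\<^sub>R z)) ` {0..}"
    have C0: "0 \<in> C" by (auto simp: C_def intro!: image_eqI[of _ _ 0])
    have Cz: "- z \<in> C" by (auto simp: C_def intro!: image_eqI[of _ _ 1])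
    have Cadd: "x + y \<in> C" if xy: "x \<in> C" "y \<in> C" for x y
    proof -
      obtain s t where "x = - (s *\<^sub>R z)" "y = - (t *\<^sub>R z)" "0 \<le> s" "0 \<le> t"
        using xy by (auto simp: C_def)
      then show ?thesis
        by (auto simp: C_def algebra_simps intro!: image_eqI[of _ _ "s + t"])
    qed
    have Cscale: "a *\<^sub>R x \<in> C" if "a > 0" "x \<in> C" for a x
      using that by (auto simp: C_def intro!: image_eqI[of _ _ "a * _"])
    \<comment> \<open>The functional \<open>\<lambda>x. - q (- x)\<close> is the least one the cone
      lemma admits, so the hypothesis \<open>gq\<close> there holds with equality. Negatives of
      points of \<open>C\<close> lie on one ray, where \<open>q\<close> is additive.\<close>
    have gadd: "- q (- (x + y)) = - q (- x) + - q (- y)" if xy: "x \<in> C" "y \<in> C" for x y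
    proof -
      obtain s t where "x = - (s *\<^sub>R z)" "y = - (t *\<^sub>R z)" "0 \<le> s" "0 \<le> t"
        using xy by (auto simp: C_def)
      moreover from this have "- (x + y) = (s + t) *\<^sub>R z" by (simp add: algebra_simps)
      ultimately have "q (- (x + y)) = (s + t) * q z" "q (- x) = s * q z" "q (- y) = t * q z"
        using sublinear_scaleR[OF q(1), of _ z] by simp_all
      then show ?thesis by (simp add: distrib_right)
    qed
    have gscale: "- q (- (a *\<^sub>R x)) = a * - q (- x)" if "a > 0" for a x
      using sublinear_scaleR[OF q(1), of a "- x"] that by simp
    obtain r where r: "sublinear r" "\<And>x. r x \<le> q x" "\<And>x. x \<in> C \<Longrightarrow> r x \<le> - q (- x)"
      using sublinear_below_on_cone[where g = "\<lambda>x. - q (- x)", OF q(1) C0 Cadd Cscale gadd gscale order_refl]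
      by blast
    have "r = q" using minimal[OF r(1)] r(2) by (simp add: le_fun_def)
    then have "q (- z) \<le> - q z" using r(3)[OF Cz] by simp
    then show ?thesis using sublinear_minus_le[OF q(1), of z] by simp
  qed
  then show ?thesis
    using that q sublinear_odd_imp_linear by blast
qed

text \<open>Convolving the multiple of the norm with \<open>f\<close> on the cone \<open>Y\<close>
  gives a sublinear functional below both. A linear functional beneath it is at most
  \<open>f\<close> on \<open>Y\<close>; evaluating at \<open>y\<close> and \<open>- y\<close> turns
  this into equality, and the same sign change gives the norm bound.\<close>

theorem hahn_banach_blinfun:
  fixes f :: "'a::real_normed_vector \<Rightarrow> real"
  assumes Y: "subspace Y" and B: "0 \<le> B"
    and fadd: "\<And>x y. x \<in> Y \<Longrightarrow> y \<in> Y \<Longrightarrow> f (x + y) = f x + f y"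
    and fscale: "\<And>c x. x \<in> Y \<Longrightarrow> f (c *\<^sub>R x) = c * f x"
    and bound: "\<And>x. x \<in> Y \<Longrightarrow> \<bar>f x\<bar> \<le> B * norm x"
  obtains g :: "'a \<Rightarrow>\<^sub>L real" where "norm g \<le> B" "\<And>y. y \<in> Y \<Longrightarrow> blinfun_apply g y = f y"
proof -
  have sub: "sublinear (\<lambda>x::'a. B * norm x)"
    unfolding sublinear_def
    using B by (auto simp: norm_triangle_ineq mult_left_mono simp flip: distrib_left)
  have lower: "- (B * norm (- x)) \<le> f x" if "x \<in> Y" for x
    using bound[OF that] by simp
  obtain p where p: "sublinear p" "\<And>x. p x \<le> B * norm x" "\<And>x. x \<in> Y \<Longrightarrow> p x \<le> f x"
    using sublinear_below_on_cone[OF sub subspace_0[OF Y] subspace_add[OF Y]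
        subspace_scale[OF Y] fadd fscale lower] by blast
  obtain h where h: "linear h" "h \<le> p" using linear_below_sublinear[OF p(1)] .
  have hB: "h x \<le> B * norm x" for x
    using le_funD[OF h(2)] p(2) by (rule order_trans)
  have habs: "\<bar>h x\<bar> \<le> B * norm x" for x
    using hB[of x] hB[of "- x"] linear_neg[OF h(1), of x] by (auto simp: abs_le_iff)
  have "bounded_linear h"
    by (rule bounded_linear_intro[of _ B])
      (use linear_add[OF h(1)] linear_scale[OF h(1)] habs in \<open>auto simp: mult.commute\<close>)
  then have app: "blinfun_apply (Blinfun h) = h"
    by (rule bounded_linear_Blinfun_apply)
  have le: "h y \<le> f y" if "y \<in> Y" for y
    using le_funD[OF h(2)] p(3)[OF that] by (rule order_trans)
  have "h y = f y" if "y \<in> Y" for y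
    using le[OF that] le[OF subspace_neg[OF Y that]] linear_neg[OF h(1), of y]
      fscale[OF that, of "- 1"] by simp
  moreover have "norm (Blinfun h) \<le> B"
    by (rule norm_blinfun_bound[OF B]) (simp add: app habs)
  ultimately show ?thesis
    using that app by metis
qed

section \<open>Duals of subspaces\<close>

text \<open>The constant \<open>B\<close> makes the supremum in \<open>dual_norm_on\<close> a
  bounded one; normalizing \<open>y\<close> then gives the estimate.\<close>

lemma abs_le_dual_norm_on:
  assumes Y: "subspace Y" and y: "y \<in> Y"
    and fscale: "\<And>c x. x \<in> Y \<Longrightarrow> f (c *\<^sub>R x) = c * f x"
    and bound: "\<And>x. x \<in> Y \<Longrightarrow> \<bar>f x\<bar> \<le> B * norm x"
  shows "\<bar>f y\<bar> \<le> dual_norm_on Y f * norm y"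
proof (cases "y = 0")
  case True
  then show ?thesis using bound[OF y] by simp
next
  case False
  have "bdd_above ((\<lambda>x. \<bar>f x\<bar>) ` (Y \<inter> cball 0 1))"
  proof (rule bdd_aboveI2)
    fix x assume x: "x \<in> Y \<inter> cball 0 1"
    then have "\<bar>f x\<bar> \<le> \<bar>B\<bar> * norm x"
      using bound[of x] mult_right_mono[OF abs_ge_self[of B] norm_ge_zero[of x]] by auto
    also have "\<dots> \<le> \<bar>B\<bar> * 1"
      using x by (intro mult_left_mono) auto
    finally show "\<bar>f x\<bar> \<le> \<bar>B\<bar> * 1" .
  qed
  then have "\<bar>f (inverse (norm y) *\<^sub>R y)\<bar> \<le> dual_norm_on Y f"
    unfolding dual_norm_on_def
    by (rule cSUP_upper[rotated]) (use False y Y in \<open>auto intro: subspace_scale\<close>)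
  then show ?thesis
    using False by (simp add: fscale[OF y] abs_mult field_simps)
qed

lemma abs_blinfun_le_dual_norm_on:
  assumes "subspace Y" "y \<in> Y"
  shows "\<bar>blinfun_apply f y\<bar> \<le> dual_norm_on Y (blinfun_apply f) * norm y"
  by (rule abs_le_dual_norm_on[OF assms, of _ "norm f"])
    (use norm_blinfun[of f] in \<open>auto simp: blinfun.scaleR_right\<close>)

lemma dual_norm_on_cong:
  "(\<And>y. y \<in> Y \<Longrightarrow> f y = (g y :: real)) \<Longrightarrow> dual_norm_on Y f = dual_norm_on Y g"
  by (auto simp: dual_norm_on_def intro!: SUP_cong)

lemma dual_norm_on_nonneg:
  assumes "subspace Y"
  shows "0 \<le> dual_norm_on Y (blinfun_apply f)"
proof -
  have "bdd_above ((\<lambda>x. \<bar>blinfun_apply f x\<bar>) ` (Y \<inter> cball 0 1))"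
  proof (rule bdd_aboveI2)
    fix x assume "x \<in> Y \<inter> cball 0 1"
    then show "\<bar>blinfun_apply f x\<bar> \<le> norm f * 1"
      using norm_blinfun[of f x] mult_left_mono[of "norm x" 1 "norm f"] by auto
  qed
  from cSUP_upper[OF _ this, of 0] show ?thesis
    using subspace_0[OF assms] by (simp add: dual_norm_on_def)
qed

lemma dual_norm_on_le_norm:
  assumes "subspace Y"
  shows "dual_norm_on Y (blinfun_apply f) \<le> norm f"
  unfolding dual_norm_on_def
proof (rule cSUP_least)
  show "Y \<inter> cball 0 1 \<noteq> {}" using subspace_0[OF assms] by auto
  fix x assume "x \<in> Y \<inter> cball 0 1"
  then show "\<bar>blinfun_apply f x\<bar> \<le> norm f"
    using norm_blinfun[of f x] mult_left_mono[of "norm x" 1 "norm f"] by auto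
qed

lemma restrict_in_dual_on:
  assumes "subspace Y"
  shows "restrict (blinfun_apply f) Y \<in> dual_on Y"
  using assms norm_blinfun[of f]
  by (auto simp: dual_on_def subspace_add subspace_scale blinfun.add_right blinfun.scaleR_right
      intro!: exI[of _ "norm f"])

text \<open>Norm-preserving Hahn--Banach extension gives one inclusion; the other holds because
  restriction does not increase the norm.\<close>

lemma dual_ball_on_eq_restrict:
  assumes Y: "subspace Y"
  shows "dual_ball_on Y = (\<lambda>f. restrict (blinfun_apply f) Y) ` cball 0 1"
proof (intro equalityI subsetI)
  fix f assume "f \<in> dual_ball_on Y"
  then have f: "f \<in> dual_on Y" "dual_norm_on Y f \<le> 1" by (auto simp: dual_ball_on_def)
  from f(1) obtain B where B: "\<And>x. x \<in> Y \<Longrightarrow> \<bar>f x\<bar> \<le> B * norm x"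
    and add: "\<And>x y. x \<in> Y \<Longrightarrow> y \<in> Y \<Longrightarrow> f (x + y) = f x + f y"
    and scale: "\<And>c x. x \<in> Y \<Longrightarrow> f (c *\<^sub>R x) = c * f x"
    and ext: "f \<in> extensional Y"
    unfolding dual_on_def by blast
  have "\<bar>f y\<bar> \<le> 1 * norm y" if "y \<in> Y" for y
    using abs_le_dual_norm_on[OF Y that scale B] mult_right_mono[OF f(2), of "norm y"] by simp
  then obtain g :: "'a \<Rightarrow>\<^sub>L real" where g: "norm g \<le> 1" "\<And>y. y \<in> Y \<Longrightarrow> blinfun_apply g y = f y"
    using hahn_banach_blinfun[OF Y zero_le_one add scale] by blast
  have "f = restrict (blinfun_apply g) Y"
    by (rule extensionalityI[OF ext]) (use g in auto)
  with g(1) show "f \<in> (\<lambda>f. restrict (blinfun_apply f) Y) ` cball 0 1" by auto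
next
  fix f :: "'a \<Rightarrow> real" assume "f \<in> (\<lambda>f. restrict (blinfun_apply f) Y) ` cball 0 1"
  then obtain g :: "'a \<Rightarrow>\<^sub>L real" where g: "norm g \<le> 1" "f = restrict (blinfun_apply g) Y" by auto
  have "dual_norm_on Y f = dual_norm_on Y (blinfun_apply g)"
    by (rule dual_norm_on_cong) (simp add: g)
  then show "f \<in> dual_ball_on Y"
    using dual_norm_on_le_norm[OF Y, of g] g restrict_in_dual_on[OF Y]
    by (simp add: dual_ball_on_def)
qed

text \<open>Restriction maps ball onto ball and keeps the value at \<open>y\<close>, so both suprema
  agree and the same \<open>\<alpha>\<close> gives the same threshold.\<close>

lemma wstar_slice_on_dual_ball_on:
  assumes Y: "subspace Y" and y: "y \<in> Y"
  shows "wstar_slice_on (dual_ball_on Y) y \<alpha> =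
    (\<lambda>f. restrict (blinfun_apply f) Y) ` wstar_slice (cball 0 1) y \<alpha>"
  using y by (auto simp: wstar_slice_on_def wstar_slice_def dual_ball_on_eq_restrict[OF Y] image_image)

text \<open>Differences of elements of the unit ball have norm at most 2, so the real supremum
  defining the diameter dominates each of them.\<close>

lemma dual_norm_on_diff_le_dual_diameter_on:
  fixes S :: "'a::real_normed_vector dual set"
  assumes Y: "subspace Y" and S: "S \<subseteq> cball 0 1" and fg: "f \<in> S" "g \<in> S"
  shows "dual_norm_on Y (blinfun_apply (f - g)) \<le>
    dual_diameter_on Y ((\<lambda>f. restrict (blinfun_apply f) Y) ` S)"
proof -
  let ?R = "\<lambda>f::'a dual. restrict (blinfun_apply f) Y"
  let ?N = "\<lambda>(u, v). dual_norm_on Y (\<lambda>y. u y - v y)"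
  have N: "?N (?R f, ?R g) = dual_norm_on Y (blinfun_apply (f - g))" for f g
    by (auto simp: minus_blinfun.rep_eq intro: dual_norm_on_cong)
  have "bdd_above (?N ` (?R ` S \<times> ?R ` S))"
  proof (rule bdd_aboveI2)
    fix w assume "w \<in> ?R ` S \<times> ?R ` S"
    then obtain u v where w: "w = (?R u, ?R v)" and "u \<in> S" "v \<in> S" by auto
    then have "norm u \<le> 1" "norm v \<le> 1"
      using S by auto
    then have "norm (u - v) \<le> 2"
      using norm_triangle_ineq4[of u v] by linarith
    then show "?N w \<le> 2"
      using dual_norm_on_le_norm[OF Y, of "u - v"] N[of u v] w by simp
  qed
  from cSUP_upper[OF _ this, of "(?R f, ?R g)"] show ?thesis
    using fg N[of f g] unfolding dual_diameter_on_def by auto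
qed

section \<open>Ideals\<close>

text \<open>Idempotence puts \<open>P f - f\<close> into the kernel of \<open>P\<close>, which is
  the annihilator of \<open>Y\<close>.\<close>

lemma ideal_projection_apply:
  assumes P: "ideal_projection Y P" and "y \<in> Y"
  shows "blinfun_apply (blinfun_apply P f) y = blinfun_apply f y"
proof -
  have "blinfun_apply P (blinfun_apply P f) = blinfun_apply P f"
    using P unfolding ideal_projection_def by (metis blinfun_apply_blinfun_compose)
  then have "blinfun_apply P (blinfun_apply P f - f) = 0"
    by (simp add: blinfun.diff_right)
  then have "blinfun_apply P f - f \<in> annihilator Y"
    using P unfolding ideal_projection_def by blast
  then show ?thesis
    using assms(2) by (simp add: annihilator_def minus_blinfun.rep_eq)
qed

lemma norm_ideal_projection_le:
  assumes "ideal_projection Y P"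
  shows "norm (blinfun_apply P f) \<le> norm f"
  using norm_blinfun[of P f] assms by (simp add: ideal_projection_def)

text \<open>As \<open>P f\<close> depends only on \<open>f\<close> restricted to \<open>Y\<close>,
  replace \<open>f\<close> by a norm-preserving extension of that restriction and use
  \<open>norm P = 1\<close>. For \<open>f\<close> in the range of \<open>P\<close> this makes
  restriction isometric.\<close>

lemma norm_ideal_projection_le_dual_norm_on:
  assumes P: "ideal_projection Y P"
  shows "norm (blinfun_apply P f) \<le> dual_norm_on Y (blinfun_apply f)"
proof -
  have Y: "subspace Y" using P by (simp add: ideal_projection_def)
  obtain g :: "'a dual" where g: "norm g \<le> dual_norm_on Y (blinfun_apply f)"
    "\<And>y. y \<in> Y \<Longrightarrow> blinfun_apply g y = blinfun_apply f y"
    by (rule hahn_banach_blinfun[OF Y dual_norm_on_nonneg[OF Y], of "blinfun_apply f" f])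
      (auto simp: blinfun.add_right blinfun.scaleR_right intro: abs_blinfun_le_dual_norm_on[OF Y])
  have "f - g \<in> annihilator Y" using g(2) by (simp add: annihilator_def minus_blinfun.rep_eq)
  then have "blinfun_apply P (f - g) = 0"
    using P unfolding ideal_projection_def by blast
  then have "blinfun_apply P f = blinfun_apply P g" by (simp add: blinfun.diff_right)
  then show ?thesis using norm_ideal_projection_le[OF P, of g] g(1) by simp
qed

text \<open>Two evaluation points are controlled at once: later one tests the norm and the other
  keeps the approximant inside the slice.\<close>

lemma strong_operator_closure_of_approx:
  fixes f :: "'a::real_normed_vector \<Rightarrow>\<^sub>L 'b::real_normed_vector"
  assumes f: "f \<in> strong_operator_topology closure_of S" and "e > 0"
  obtains g where "g \<in> S" "norm (blinfun_apply g x - blinfun_apply f x) < e"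
    "norm (blinfun_apply g y - blinfun_apply f y) < e"
proof -
  define V where "V z = {g. blinfun_apply g z \<in> ball (blinfun_apply f z) e}" for z
  have V: "openin strong_operator_topology (V z)" for z
    using openin_continuous_map_preimage
      [OF strong_operator_topology_continuous_evaluation[of z], of "ball (blinfun_apply f z) e"]
    by (simp add: V_def strong_operator_topology_topspace)
  have "openin strong_operator_topology (V x \<inter> V y)"
    by (intro openin_Int V)
  moreover have "f \<in> V x \<inter> V y" using assms(2) by (simp add: V_def)
  ultimately obtain g where "g \<in> S" "g \<in> V x \<inter> V y"
    using f unfolding in_closure_of by blast
  then show ?thesis using that by (auto simp: V_def dist_norm norm_minus_commute)
qed

lemma diameter_wstar_slice_le:
  fixes P :: "'a::real_normed_vector dual \<Rightarrow>\<^sub>L 'a dual"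
  assumes P: "strict_ideal_projection Y P" and y: "y \<in> Y" and ne: "wstar_slice (cball 0 1) y \<alpha> \<noteq> {}"
  shows "diameter (wstar_slice (cball 0 1) y \<alpha>) \<le>
    dual_diameter_on Y (wstar_slice_on (dual_ball_on Y) y \<alpha>)"
proof -
  let ?S = "wstar_slice (cball 0 1) y \<alpha> :: 'a dual set"
  let ?d = "dual_diameter_on Y (wstar_slice_on (dual_ball_on Y) y \<alpha>)"
  let ?t = "(SUP g\<in>cball 0 1. blinfun_apply (g :: 'a dual) y) - \<alpha>"
  have iP: "ideal_projection Y P" and Y: "subspace Y"
    using P by (auto simp: strict_ideal_projection_def ideal_projection_def)
  have range: "norm (u - v) \<le> ?d" if uv: "u \<in> range P \<inter> ?S" "v \<in> range P \<inter> ?S" for u v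
  proof -
    have "P o\<^sub>L P = P" using iP by (simp add: ideal_projection_def)
    then have "P w = w" if "w \<in> range P" for w
      using that by (metis blinfun_apply_blinfun_compose imageE)
    then have "P u = u" "P v = v" using uv by blast+
    then have "P (u - v) = u - v" by (simp add: blinfun.diff_right)
    then have "norm (u - v) \<le> dual_norm_on Y (u - v)"
      using norm_ideal_projection_le_dual_norm_on[OF iP, of "u - v"] by simp
    also have "\<dots> \<le> ?d"
      unfolding wstar_slice_on_dual_ball_on[OF Y y]
      by (rule dual_norm_on_diff_le_dual_diameter_on[OF Y]) (use uv in \<open>auto simp: wstar_slice_def\<close>)
    finally show ?thesis .
  qed
  have approx: "\<exists>u \<in> range P \<inter> ?S. \<bar>u x - f x\<bar> < e" if f: "f \<in> ?S" and "e > 0" for f x e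
  proof -
    have "f \<in> strong_operator_topology closure_of (range P \<inter> cball 0 1)"
      using f P by (auto simp: strict_ideal_projection_def wstar_slice_def)
    \<comment> \<open>The slack \<open>f y - ?t\<close> is the tolerance at \<open>y\<close>: an
      approximant this close still exceeds the threshold of the slice.\<close>
    moreover have "min e (f y - ?t) > 0" using that by (simp add: wstar_slice_def)
    ultimately obtain u where u: "u \<in> range P \<inter> cball 0 1"
      "norm (u x - f x) < min e (f y - ?t)" "norm (u y - f y) < min e (f y - ?t)"
      by (rule strong_operator_closure_of_approx)
    then have "u y > ?t" by (simp add: abs_less_iff)
    with u show ?thesis by (auto simp: wstar_slice_def)
  qed
  \<comment> \<open>Density puts some \<open>u\<close> of \<open>range P\<close> into the nonempty
    slice, and \<open>range\<close> applies to the pair \<open>u\<close>, \<open>u\<close>; the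
    radius 1 and the point 0 are arbitrary.\<close>
  have d0: "0 \<le> ?d"
    using ne approx[of _ 1 0] range norm_ge_zero order_trans by (metis ex_in_conv zero_less_one)
  have "norm (f - g) \<le> ?d" if f: "f \<in> ?S" and g: "g \<in> ?S" for f g
  proof (rule norm_blinfun_bound[OF d0])
    fix x
    \<comment> \<open>Weak-star lower semicontinuity of the norm by hand: the approximants
      \<open>u\<close> and \<open>v\<close> depend on \<open>x\<close> and \<open>e\<close>, but
      their distance is at most \<open>?d\<close> uniformly.\<close>
    have "\<bar>f x - g x\<bar> \<le> ?d * norm x + e" if "e > 0" for e
    proof -
      obtain u v where uv: "u \<in> range P \<inter> ?S" "v \<in> range P \<inter> ?S"
        "\<bar>u x - f x\<bar> < e / 2" "\<bar>v x - g x\<bar> < e / 2"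
        using approx[OF f, of "e / 2" x] approx[OF g, of "e / 2" x] \<open>e > 0\<close> by auto
      have "\<bar>u x - v x\<bar> \<le> norm (u - v) * norm x"
        using norm_blinfun[of "u - v" x] by (simp add: minus_blinfun.rep_eq)
      also have "\<dots> \<le> ?d * norm x"
        using range[OF uv(1,2)] by (simp add: mult_right_mono)
      finally show ?thesis using uv by linarith
    qed
    then show "norm ((f - g) x) \<le> ?d * norm x"
      by (auto simp: minus_blinfun.rep_eq intro: field_le_epsilon)
  qed
  then show ?thesis
    by (intro diameter_le) (use ne in \<open>auto simp: dist_norm\<close>)
qed

theorem proposition10:
  fixes Y :: "'a::banach set"
    and P :: "'a dual \<Rightarrow>\<^sub>L 'a dual"
    and ystar :: "'a \<Rightarrow> real"
  assumes "strict_ideal_projection Y P"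
    and "wstar_denting_point_on Y (dual_ball_on Y) ystar"
  shows "wstar_denting_point (cball 0 1) (ideal_embedding Y P ystar)"
proof -
  have iP: "ideal_projection Y P" and Y: "subspace Y"
    using assms(1) by (auto simp: strict_ideal_projection_def ideal_projection_def)
  have "ystar \<in> dual_ball_on Y"
    using assms(2) by (simp add: wstar_denting_point_on_def)
  then obtain g where g: "norm g \<le> 1" "ystar = restrict (blinfun_apply g) Y"
    unfolding dual_ball_on_eq_restrict[OF Y] by auto
  define e where "e = ideal_embedding Y P ystar"
  \<comment> \<open>The embedding does not depend on the extension chosen, so one of norm at most 1
    may be used; this puts \<open>e\<close> in the ball.\<close>
  have e: "e = blinfun_apply P g"
    unfolding e_def by (rule ideal_embedding_eq[OF iP]) (simp add: g)
  have eY: "blinfun_apply e y = ystar y" if "y \<in> Y" for y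
    using ideal_projection_apply[OF iP that, of g] that by (simp add: e g)
  have ball: "e \<in> cball 0 1"
    using norm_ideal_projection_le[OF iP, of g] g(1) by (simp add: e)
  have "e \<noteq> 0"
    using assms(2) eY by (force simp: wstar_denting_point_on_def)
  moreover have "\<exists>x \<alpha>. norm x = 1 \<and> \<alpha> > 0 \<and> e \<in> wstar_slice (cball 0 1) x \<alpha> \<and>
      diameter (wstar_slice (cball 0 1 :: 'a dual set) x \<alpha>) < \<epsilon>" if \<epsilon>: "\<epsilon> > 0" for \<epsilon>
  proof -
    obtain y \<alpha> where y: "y \<in> Y" "norm y = 1" "\<alpha> > 0"
      and slice: "ystar \<in> wstar_slice_on (dual_ball_on Y) y \<alpha>"
      and small: "dual_diameter_on Y (wstar_slice_on (dual_ball_on Y) y \<alpha>) < \<epsilon>"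
      using assms(2) \<epsilon> unfolding wstar_denting_point_on_def by blast
    \<comment> \<open>Some functional in the big slice restricts to \<open>ystar\<close>, hence has
      the same value at \<open>y\<close> as \<open>e\<close>; for a member of the ball that value
      decides membership.\<close>
    have "e \<in> wstar_slice (cball 0 1) y \<alpha>"
      using slice ball eY[OF y(1)] y(1)
      unfolding wstar_slice_on_dual_ball_on[OF Y y(1)] by (auto simp: wstar_slice_def)
    then show ?thesis
      using diameter_wstar_slice_le[OF assms(1) y(1), of \<alpha>] y small by force
  qed
  ultimately show ?thesis
    using ball unfolding wstar_denting_point_def e_def by blast
qed

end
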